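(* (a i) Let $(X,d)$ be a metric space admitting a polynomially standard representation $\xi:\subseteq\mathcal C\twoheadrightarrow X$, and let $\xi':\subseteq\mathcal C\twoheadrightarrow X$ be a polynomially admissible representation. Then $\xi'$ is polynomially standard. (a ii) Let $(X,d)$ be a metric space admitting a linearly standard representation $\xi:\subseteq\mathcal C\twoheadrightarrow X$, and let $\xi':\subseteq\mathcal C\twoheadrightarrow X$ be a linearly admissible representation. Then $\xi'$ is linearly standard. (b) Let $(X,d)$ be a metric space with entropy $\eta$, let $(Y,e)$ be a metric space, $\xi:\subseteq\mathcal C\twoheadrightarrow X$ a representation, $f:X\to Y$, and let $\lambda:\mathbb N\to\mathbb N$ be non-decreasing such that $f\circ\xi$ has modulus of continuity $\eta\circ\lambda$. (b i) If $\xi$ is polynomially standard, then there is $c\in\mathbb N$ such that $f$ has modulus of continuity $n\mapsto c+c\cdot\lambda(n)^c$. (b ii) If $\xi$ is linearly standard, then there is $c\in\mathbb N$ such that $f$ has modulus of continuity $n\mapsto c+c\cdot\lambda(n)$. In (c) and (d), let $(X,d)$ and $(Y,e)$ be metric spaces with entropies $\eta$ and $\theta$, respectively, with representations $\xi:\subseteq\mathcal C\twoheadrightarrow X$ and $\upsilon:\subseteq\mathcal C\twoheadrightarrow Y$, and let $\lambda:\mathbb N\to\mathbb N$ be non-decreasing. (c i) Suppose $\xi,\upsilon$ are polynomially standard and $f:X\to Y$ has modulus of continuity $\lambda$. Then $f$ admits a $(\xi,\upsilon)$-realizer $F:\mathrm{dom}(\xi)\to\mathrm{dom}(\upsilon)$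 with a modulus of continuity $\Lambda$ for which there are polynomials $p,q$ with natural-number coefficients such that $\Lambda(\theta(n))\le\eta\big(p(\lambda(q(n)))\big)$ for all $n\in\mathbb N$. (c ii) Suppose $\xi,\upsilon$ are linearly standard and $f:X\to Y$ has modulus of continuity $\lambda$. Then $f$ admits a $(\xi,\upsilon)$-realizer $F$ with a modulus of continuity $\Lambda$ for which there is $c\in\mathbb N$ such that $\Lambda(\theta(n))\le\eta\big(c+c\cdot\lambda(c+c\cdot n)\big)$ for all $n\in\mathbb N$. (d i) Suppose $\xi,\upsilon$ are polynomially standard and $f:X\to Y$ admits a $(\xi,\upsilon)$-realizer $F$ with modulus of continuity $\eta\circ\lambda$. Then there are polynomials $p,q$ with natural-number coefficients such that $f$ has modulus of continuity $p\circ\lambda\circ\theta\circ q$. (d ii) Suppose $\xi,\upsilon$ are linearly standard and $f:X\to Y$ admits a $(\xi,\upsilon)$-realizer $F$ with modulus of continuity $\eta\circ\lambda$. Then there is $c\in\mathbb N$ such that $f$ has modulus of continuity $n\mapsto c+c\cdot\lambda\big(\theta(c+c\cdot n)\big)$.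
   Context: $\mathbb N=\{0,1,2,\dots\}$. Cantor space $\mathcal C=\{0,1\}^{\mathbb N}$ carries the metric $D(\bar u,\bar v)=2^{-\min\{n:u_n\neq v_n\}}$ for $\bar u\ne\bar v$, and $D(\bar u,\bar u)=0$. Modulus: a modulus of continuity of $f:(X,d)\to(Y,e)$ is a non-decreasing $\mu:\mathbb N\to\mathbb N$ such that for all $n$ and all $x,x'$: $d(x,x')\le2^{-\mu(n)}$ implies $e(f(x),f(x'))\le2^{-n}$. For a partial map, $x,x'$ range over its domain (a metric subspace). The minimal modulus is the pointwise least one. Entropy: the (binary) entropy of $X$ is $\eta(n)=\lceil\log_2\hat\eta(n)\rceil$, where $\hat\eta(n)$ is the least number of closed balls of radius $2^{-n}$ with centers in $X$ that cover $X$. Representation: a surjective partial map $\xi:\subseteq\mathcal C\twoheadrightarrow X$. Given representations $\xi$ of $X$ and $\upsilon$ of $Y$, a $(\xi,\upsilon)$-realizer of $f:X\to Y$ is a map $F:\mathrm{dom}(\xi)\to\mathrm{dom}(\upsilon)$ with $f(\xi(u))=\upsilon(F(u))$ for all $u\in\mathrm{dom}(\xi)$. The induced semi-metric is $d_\xi(x,x')=\min\{D(u,u'):\xi(u)=x,\ \xi(u')=x'\}$. Reductions: let $\xi,\xi':\subseteq\mathcal C\to X$ be partial maps (not necessarily surjective) with minimal moduli of continuity $\mu,\mu'$. A polynomial (resp. linear) reduction from $\xi'$ to $\xi$ is a map $G:\mathrm{dom}(\xi')\to\mathrm{dom}(\xi)$ with a modulus of continuity $\nu$ such that $\xi'(u)=\xi(G(u))$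 for all $u\in\mathrm{dom}(\xi')$ and, for some $c\in\mathbb N$ and all $n$, $\nu(\mu(n))\le\mu'(c+c\,n^c)$ (resp. $\nu(\mu(n))\le\mu'(c+c\,n)$). Let $(X,d)$ have entropy $\eta$ and let $\xi:\subseteq\mathcal C\twoheadrightarrow X$ be a representation with minimal modulus of continuity $\mu$. - $\xi$ is polynomially admissible if: (1) for some $c$ and all $n$, $\mu(n)\le\eta(c+c\,n^c)$; and (2) every surjective partial $\xi':\subseteq\mathcal C\twoheadrightarrow X$ possessing a modulus of continuity has a polynomial reduction to $\xi$. - $\xi$ is polynomially standard if (1) holds; (2') every (not necessarily surjective) partial $\xi':\subseteq\mathcal C\to X$ possessing a modulus of continuity has a polynomial reduction to $\xi$; and (3) there is a polynomial $p$ with natural-number coefficients such that for all $n$ and $x,x'\in X$, $d(x,x')\le2^{-p(n)}$ implies $d_\xi(x,x')\le2^{-\eta(n)}$. - $\xi$ is linearly admissible / linearly standard if the same conditions hold with $c+c\,n$ in place of $c+c\,n^c$, with linear in place of polynomial reductions, and with $p(n)$ of the form $c+c\,n$. *)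

theory Defs
  imports "HOL-Analysis.Analysis" "HOL-Computational_Algebra.Polynomial"
begin

section \<open>Cantor space\<close>

type_synonym cantor = "nat \<Rightarrow> bool"

definition cantor_dist :: "cantor \<Rightarrow> cantor \<Rightarrow> real" where
  "cantor_dist u v = (if u = v then 0 else 1 / 2 ^ (LEAST n. u n \<noteq> v n))"

lemma cantor_dist_le_iff: "cantor_dist u v \<le> 1 / 2 ^ k \<longleftrightarrow> (\<forall>i<k. u i = v i)"
proof (cases "u = v")
  case False
  then obtain j where j: "u j \<noteq> v j" by auto
  define m where "m = (LEAST n. u n \<noteq> v n)"
  have m: "u m \<noteq> v m" unfolding m_def using j by (rule LeastI)
  have m': "u i = v i" if "i < m" for i using that not_less_Least m_def by blast
  have "cantor_dist u v \<le> 1 / 2 ^ k \<longleftrightarrow> k \<le> m"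
    using False by (simp add: cantor_dist_def m_def field_simps)
  also have "\<dots> \<longleftrightarrow> (\<forall>i<k. u i = v i)"
    using m m' by (metis less_le_trans not_le)
  finally show ?thesis .
qed (simp add: cantor_dist_def)

lemma Metric_space_cantor: "Metric_space UNIV cantor_dist"
proof
  fix u v w :: cantor
  show "0 \<le> cantor_dist u v" by (simp add: cantor_dist_def)
  show "cantor_dist u v = cantor_dist v u"
    by (simp add: cantor_dist_def eq_commute[of u v] eq_commute[of "u n" "v n" for n])
  show "cantor_dist u v = 0 \<longleftrightarrow> u = v" by (simp add: cantor_dist_def)
  show "cantor_dist u w \<le> cantor_dist u v + cantor_dist v w"
  proof (cases "u = w")
    case False
    define m where "m = (LEAST n. u n \<noteq> w n)"
    have uw: "cantor_dist u w = 1 / 2 ^ m" using False by (simp add: cantor_dist_def m_def)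
    have "u m \<noteq> w m" unfolding m_def by (rule LeastI_ex) (use False in \<open>simp add: fun_eq_iff\<close>)
    then have "u m \<noteq> v m \<or> v m \<noteq> w m" by metis
    moreover have "1 / 2 ^ m \<le> cantor_dist a b" if "a m \<noteq> b m" for a b
    proof -
      have "(LEAST n. a n \<noteq> b n) \<le> m" using that by (rule Least_le)
      then show ?thesis using that by (auto simp: cantor_dist_def field_simps)
    qed
    moreover have "0 \<le> cantor_dist u v" "0 \<le> cantor_dist v w"
      by (simp_all add: cantor_dist_def)
    ultimately show ?thesis unfolding uw
      by (metis add_increasing add_increasing2)
  qed (simp add: cantor_dist_def)
qed

definition cantor_metric :: "cantor metric" where
  "cantor_metric = metric (UNIV, cantor_dist)"

lemma mspace_cantor [simp]: "mspace cantor_metric = UNIV"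
  and mdist_cantor [simp]: "mdist cantor_metric = cantor_dist"
  using Metric_space_cantor
  by (simp_all add: cantor_metric_def Metric_space.mspace_metric Metric_space.mdist_metric)

text \<open>A partial map from Cantor space is given by its domain \<open>A\<close> together with a total
  function \<open>\<xi>\<close> whose values outside \<open>A\<close> are irrelevant; the domain carries the subspace metric.\<close>

abbreviation cantor_on :: "cantor set \<Rightarrow> cantor metric" where
  "cantor_on A \<equiv> submetric cantor_metric A"


section \<open>Moduli of continuity\<close>

definition modulus :: "'a metric \<Rightarrow> 'b metric \<Rightarrow> ('a \<Rightarrow> 'b) \<Rightarrow> (nat \<Rightarrow> nat) \<Rightarrow> bool" where
  "modulus X Y f \<mu> \<longleftrightarrow>
     f \<in> mspace X \<rightarrow> mspace Y \<and> mono \<mu> \<and>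
     (\<forall>n. \<forall>x\<in>mspace X. \<forall>x'\<in>mspace X.
        mdist X x x' \<le> 1 / 2 ^ \<mu> n \<longrightarrow> mdist Y (f x) (f x') \<le> 1 / 2 ^ n)"

text \<open>The order on functions is pointwise, so this is the pointwise least modulus;
  it exists as soon as some modulus does.\<close>

definition minimal_modulus :: "'a metric \<Rightarrow> 'b metric \<Rightarrow> ('a \<Rightarrow> 'b) \<Rightarrow> nat \<Rightarrow> nat" where
  "minimal_modulus X Y f = (LEAST \<mu>. modulus X Y f \<mu>)"

lemma minimal_modulus:
  assumes "modulus X Y f \<mu>"
  shows "modulus X Y f (minimal_modulus X Y f)" and "minimal_modulus X Y f n \<le> \<mu> n"
proof -
  define m where "m n = (LEAST k. \<exists>\<nu>. modulus X Y f \<nu> \<and> \<nu> n = k)" for n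
  have ex: "\<exists>\<nu>. modulus X Y f \<nu> \<and> \<nu> n = m n" for n
    unfolding m_def by (rule LeastI_ex) (use assms in blast)
  have le: "m n \<le> \<nu> n" if "modulus X Y f \<nu>" for \<nu> n
    unfolding m_def by (rule Least_le) (use that in blast)
  have "mono m"
  proof
    fix i j :: nat assume "i \<le> j"
    obtain \<nu> where \<nu>: "modulus X Y f \<nu>" "\<nu> j = m j" using ex by blast
    have "\<nu> i \<le> \<nu> j" using \<nu>(1) \<open>i \<le> j\<close> unfolding modulus_def mono_def by blast
    then show "m i \<le> m j" using le[OF \<nu>(1), of i] \<nu>(2) by simp
  qed
  moreover have "mdist Y (f x) (f x') \<le> 1 / 2 ^ n"
    if "x \<in> mspace X" "x' \<in> mspace X" "mdist X x x' \<le> 1 / 2 ^ m n" for n x x'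
  proof -
    obtain \<nu> where \<nu>: "modulus X Y f \<nu>" "\<nu> n = m n" using ex by blast
    have "mdist X x x' \<le> 1 / 2 ^ \<nu> n" using that(3) \<nu>(2) by simp
    then show ?thesis using \<nu>(1) that(1,2) unfolding modulus_def by blast
  qed
  ultimately have m: "modulus X Y f m" using assms unfolding modulus_def by blast
  have "minimal_modulus X Y f = m" unfolding minimal_modulus_def
    by (rule Least_equality) (use m le in \<open>auto simp: le_fun_def\<close>)
  then show "modulus X Y f (minimal_modulus X Y f)" "minimal_modulus X Y f n \<le> \<mu> n"
    using m le[OF assms] by simp_all
qed


section \<open>Entropy\<close>

definition covering_number :: "'a metric \<Rightarrow> nat \<Rightarrow> nat" where
  "covering_number X n =
     (LEAST k. \<exists>C \<subseteq> mspace X. finite C \<and> card C = k \<and>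
        mspace X \<subseteq> (\<Union>x\<in>C. mcball_of X x (1 / 2 ^ n)))"

text \<open>Meaningful for totally bounded \<open>X\<close> only; the lemma \<open>representation_finite_cover\<close> below shows
  that this is automatic when \<open>X\<close> has a representation with a modulus of continuity.
  On the empty space the value is \<open>0\<close>, as \<open>log 2 0 = 0\<close>.\<close>

definition entropy :: "'a metric \<Rightarrow> nat \<Rightarrow> nat" where
  "entropy X n = nat \<lceil>log 2 (real (covering_number X n))\<rceil>"


section \<open>Representations\<close>

definition representation :: "'a metric \<Rightarrow> cantor set \<Rightarrow> (cantor \<Rightarrow> 'a) \<Rightarrow> bool" where
  "representation X A \<xi> \<longleftrightarrow> \<xi> ` A = mspace X"

lemma representation_finite_cover:
  assumes "representation X A \<xi>" "modulus (cantor_on A) X \<xi> \<mu>"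
  shows "\<exists>C \<subseteq> mspace X. finite C \<and> mspace X \<subseteq> (\<Union>x\<in>C. mcball_of X x (1 / 2 ^ n))"
proof -
  let ?h = "\<lambda>u::cantor. {i. i < \<mu> n \<and> u i}"
  have "?h ` A \<subseteq> Pow {..<\<mu> n}" by auto
  then have "finite (?h ` A)" by (rule finite_subset) simp
  then obtain B where B: "B \<subseteq> A" "finite B" "?h ` A = ?h ` B"
    using finite_subset_image[of "?h ` A" ?h A] by blast
  have "mspace X \<subseteq> (\<Union>x\<in>\<xi> ` B. mcball_of X x (1 / 2 ^ n))"
  proof
    fix x assume x: "x \<in> mspace X"
    then obtain u where u: "u \<in> A" "x = \<xi> u" using assms(1) by (auto simp: representation_def)
    then obtain v where v: "v \<in> B" "?h u = ?h v" using B by blast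
    then have "cantor_dist v u \<le> 1 / 2 ^ \<mu> n" by (auto simp: cantor_dist_le_iff)
    then have "mdist X (\<xi> v) (\<xi> u) \<le> 1 / 2 ^ n"
      using assms(2) u(1) v(1) B(1) by (auto simp: modulus_def)
    moreover have "\<xi> v \<in> mspace X" using assms(1) v(1) B(1) by (auto simp: representation_def)
    ultimately show "x \<in> (\<Union>x\<in>\<xi> ` B. mcball_of X x (1 / 2 ^ n))" using u v x by auto
  qed
  moreover have "\<xi> ` B \<subseteq> mspace X" using assms(1) B(1) by (auto simp: representation_def)
  ultimately show ?thesis using B(2) by blast
qed

definition realizer ::
    "cantor set \<Rightarrow> (cantor \<Rightarrow> 'a) \<Rightarrow> cantor set \<Rightarrow> (cantor \<Rightarrow> 'b) \<Rightarrow> ('a \<Rightarrow> 'b) \<Rightarrow> (cantor \<Rightarrow> cantor) \<Rightarrow> bool"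
  where
  "realizer A \<xi> B \<upsilon> f F \<longleftrightarrow> F \<in> A \<rightarrow> B \<and> (\<forall>u\<in>A. f (\<xi> u) = \<upsilon> (F u))"

text \<open>The minimum is attained for \<open>x, x'\<close> in the range of a uniformly continuous \<open>\<xi>\<close>, since
  \<^const>\<open>cantor_dist\<close> takes only the values \<open>0\<close> and \<open>1 / 2 ^ k\<close>.\<close>

definition induced_dist :: "cantor set \<Rightarrow> (cantor \<Rightarrow> 'a) \<Rightarrow> 'a \<Rightarrow> 'a \<Rightarrow> real" where
  "induced_dist A \<xi> x x' =
     (LEAST r. \<exists>u\<in>A. \<exists>u'\<in>A. \<xi> u = x \<and> \<xi> u' = x' \<and> r = cantor_dist u u')"


section \<open>Reductions\<close>

definition polynomial_reduction ::
    "'a metric \<Rightarrow> cantor set \<Rightarrow> (cantor \<Rightarrow> 'a) \<Rightarrow> cantor set \<Rightarrow> (cantor \<Rightarrow> 'a) \<Rightarrow> bool" where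
  "polynomial_reduction X A' \<xi>' A \<xi> \<longleftrightarrow>
     (\<exists>G \<nu>. modulus (cantor_on A') (cantor_on A) G \<nu> \<and>
        (\<forall>u\<in>A'. \<xi>' u = \<xi> (G u)) \<and>
        (\<exists>c. \<forall>n. \<nu> (minimal_modulus (cantor_on A) X \<xi> n)
                   \<le> minimal_modulus (cantor_on A') X \<xi>' (c + c * n ^ c)))"

definition linear_reduction ::
    "'a metric \<Rightarrow> cantor set \<Rightarrow> (cantor \<Rightarrow> 'a) \<Rightarrow> cantor set \<Rightarrow> (cantor \<Rightarrow> 'a) \<Rightarrow> bool" where
  "linear_reduction X A' \<xi>' A \<xi> \<longleftrightarrow>
     (\<exists>G \<nu>. modulus (cantor_on A') (cantor_on A) G \<nu> \<and>
        (\<forall>u\<in>A'. \<xi>' u = \<xi> (G u)) \<and>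
        (\<exists>c. \<forall>n. \<nu> (minimal_modulus (cantor_on A) X \<xi> n)
                   \<le> minimal_modulus (cantor_on A') X \<xi>' (c + c * n)))"


section \<open>Admissible and standard representations\<close>

definition polynomially_admissible :: "'a metric \<Rightarrow> cantor set \<Rightarrow> (cantor \<Rightarrow> 'a) \<Rightarrow> bool" where
  "polynomially_admissible X A \<xi> \<longleftrightarrow>
     representation X A \<xi> \<and> (\<exists>\<mu>. modulus (cantor_on A) X \<xi> \<mu>) \<and>
     (\<exists>c. \<forall>n. minimal_modulus (cantor_on A) X \<xi> n \<le> entropy X (c + c * n ^ c)) \<and>
     (\<forall>A' \<xi>'. representation X A' \<xi>' \<and> (\<exists>\<mu>'. modulus (cantor_on A') X \<xi>' \<mu>')
        \<longrightarrow> polynomial_reduction X A' \<xi>' A \<xi>)"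

definition linearly_admissible :: "'a metric \<Rightarrow> cantor set \<Rightarrow> (cantor \<Rightarrow> 'a) \<Rightarrow> bool" where
  "linearly_admissible X A \<xi> \<longleftrightarrow>
     representation X A \<xi> \<and> (\<exists>\<mu>. modulus (cantor_on A) X \<xi> \<mu>) \<and>
     (\<exists>c. \<forall>n. minimal_modulus (cantor_on A) X \<xi> n \<le> entropy X (c + c * n)) \<and>
     (\<forall>A' \<xi>'. representation X A' \<xi>' \<and> (\<exists>\<mu>'. modulus (cantor_on A') X \<xi>' \<mu>')
        \<longrightarrow> linear_reduction X A' \<xi>' A \<xi>)"

definition polynomially_standard :: "'a metric \<Rightarrow> cantor set \<Rightarrow> (cantor \<Rightarrow> 'a) \<Rightarrow> bool" where
  "polynomially_standard X A \<xi> \<longleftrightarrow>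
     representation X A \<xi> \<and> (\<exists>\<mu>. modulus (cantor_on A) X \<xi> \<mu>) \<and>
     (\<exists>c. \<forall>n. minimal_modulus (cantor_on A) X \<xi> n \<le> entropy X (c + c * n ^ c)) \<and>
     (\<forall>A' \<xi>'. (\<exists>\<mu>'. modulus (cantor_on A') X \<xi>' \<mu>') \<longrightarrow> polynomial_reduction X A' \<xi>' A \<xi>) \<and>
     (\<exists>p :: nat poly. \<forall>n. \<forall>x\<in>mspace X. \<forall>x'\<in>mspace X.
        mdist X x x' \<le> 1 / 2 ^ poly p n \<longrightarrow> induced_dist A \<xi> x x' \<le> 1 / 2 ^ entropy X n)"

definition linearly_standard :: "'a metric \<Rightarrow> cantor set \<Rightarrow> (cantor \<Rightarrow> 'a) \<Rightarrow> bool" where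
  "linearly_standard X A \<xi> \<longleftrightarrow>
     representation X A \<xi> \<and> (\<exists>\<mu>. modulus (cantor_on A) X \<xi> \<mu>) \<and>
     (\<exists>c. \<forall>n. minimal_modulus (cantor_on A) X \<xi> n \<le> entropy X (c + c * n)) \<and>
     (\<forall>A' \<xi>'. (\<exists>\<mu>'. modulus (cantor_on A') X \<xi>' \<mu>') \<longrightarrow> linear_reduction X A' \<xi>' A \<xi>) \<and>
     (\<exists>c. \<forall>n. \<forall>x\<in>mspace X. \<forall>x'\<in>mspace X.
        mdist X x x' \<le> 1 / 2 ^ (c + c * n) \<longrightarrow> induced_dist A \<xi> x x' \<le> 1 / 2 ^ entropy X n)"

end

theory Submission
  imports Defs
begin

text \<open>A representation with modulus \<open>\<mu>\<close> covers its space by the at most \<open>2 ^ \<mu> n\<close> images of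
  cylinder sets, so \<open>entropy X n \<le> \<mu> n\<close>. Hence the conditions \<open>\<nu> (\<mu> n) \<le> \<mu>' (q n)\<close> on reductions
  also bound \<open>\<nu>\<close> at the entropy, and with condition (1), \<open>\<mu> n \<le> entropy X (q n)\<close>, entropy and
  minimal modulus are interchangeable up to an index change from the growth class. Part (b) lifts close
  points to close names by condition (3); (c) reduces \<open>f \<circ> \<xi>\<close> to \<open>\<upsilon>\<close>; (d) applies (b) to
  \<open>\<upsilon> \<circ> F = f \<circ> \<xi>\<close>; and (a) composes reductions through \<open>\<xi>\<close>. Apart from monotonicity,
  only closure under composition matters for the growth class, so the polynomial and the linear
  case are treated at once.\<close>

section \<open>Moduli and entropy\<close>

lemma modulus_cantor_iff:
  "modulus (cantor_on A) X \<xi> \<mu> \<longleftrightarrow>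
     \<xi> \<in> A \<rightarrow> mspace X \<and> mono \<mu> \<and>
     (\<forall>n. \<forall>u\<in>A. \<forall>u'\<in>A. cantor_dist u u' \<le> 1 / 2 ^ \<mu> n \<longrightarrow> mdist X (\<xi> u) (\<xi> u') \<le> 1 / 2 ^ n)"
  by (simp add: modulus_def)

lemma modulus_mono: "modulus X Y f \<mu> \<Longrightarrow> m \<le> n \<Longrightarrow> \<mu> m \<le> \<mu> n"
  by (simp add: modulus_def mono_def)

lemma inverse_two_power_antimono: "m \<le> n \<Longrightarrow> (1::real) / 2 ^ n \<le> 1 / 2 ^ m"
  by (simp add: frac_le)

lemma modulus_weaken:
  assumes "modulus X Y f \<mu>" "mono \<nu>" "\<And>n. \<mu> n \<le> \<nu> n"
  shows "modulus X Y f \<nu>"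
  unfolding modulus_def
proof (intro conjI allI ballI impI)
  fix n x x' assume "x \<in> mspace X" "x' \<in> mspace X" "mdist X x x' \<le> 1 / 2 ^ \<nu> n"
  then show "mdist Y (f x) (f x') \<le> 1 / 2 ^ n"
    using assms(1) inverse_two_power_antimono[OF assms(3)[of n]]
    unfolding modulus_def by (meson order_trans)
qed (use assms in \<open>auto simp: modulus_def\<close>)

text \<open>Moduli compose in the opposite order to the maps: precision \<open>n\<close> after
  \<open>g\<close> requires precision \<open>\<nu> n\<close> after \<open>f\<close>.\<close>

lemma modulus_comp:
  assumes "modulus X Y f \<mu>" "modulus Y Z g \<nu>"
  shows "modulus X Z (g \<circ> f) (\<mu> \<circ> \<nu>)"
  using assms unfolding modulus_def
  by (auto simp: Pi_iff mono_def)

lemma modulus_cong: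
  assumes "modulus X Y f \<mu>" "\<And>x. x \<in> mspace X \<Longrightarrow> f x = g x"
  shows "modulus X Y g \<mu>"
  using assms unfolding modulus_def by (auto simp: Pi_iff)

section \<open>Covering numbers and entropy of represented spaces\<close>

lemma covering_number_le:
  assumes "C \<subseteq> mspace X" "finite C" "mspace X \<subseteq> (\<Union>x\<in>C. mcball_of X x (1 / 2 ^ n))"
  shows "covering_number X n \<le> card C"
  unfolding covering_number_def by (rule Least_le) (use assms in blast)

text \<open>A \<open>LEAST\<close> carries information only if some value qualifies, so total
  boundedness at this radius has to be supplied.\<close>

lemma covering_number_witness:
  assumes "\<exists>C \<subseteq> mspace X. finite C \<and> mspace X \<subseteq> (\<Union>x\<in>C. mcball_of X x (1 / 2 ^ n))"
  obtains C where "C \<subseteq> mspace X" "finite C" "card C = covering_number X n"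
    "mspace X \<subseteq> (\<Union>x\<in>C. mcball_of X x (1 / 2 ^ n))"
proof -
  let ?P = "\<lambda>k. \<exists>C \<subseteq> mspace X. finite C \<and> card C = k \<and>
        mspace X \<subseteq> (\<Union>x\<in>C. mcball_of X x (1 / 2 ^ n))"
  have "\<exists>k. ?P k" using assms by blast
  then have "?P (covering_number X n)" unfolding covering_number_def by (rule LeastI_ex)
  then show thesis using that by blast
qed

lemma entropy_mono:
  assumes "\<And>n. \<exists>C \<subseteq> mspace X. finite C \<and> mspace X \<subseteq> (\<Union>x\<in>C. mcball_of X x (1 / 2 ^ n))"
    and "m \<le> n"
  shows "entropy X m \<le> entropy X n"
\<comment> \<open>The logarithm is monotone on positive arguments only; the value 0 is settled by
  \<open>log 2 0 = 0\<close>.\<close>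
proof (cases "covering_number X m = 0")
  case False
  obtain C where C: "C \<subseteq> mspace X" "finite C" "card C = covering_number X n"
    "mspace X \<subseteq> (\<Union>x\<in>C. mcball_of X x (1 / 2 ^ n))"
    using covering_number_witness[OF assms(1)] .
  have "mcball_of X x (1 / 2 ^ n) \<subseteq> mcball_of X x (1 / 2 ^ m)" for x
    using inverse_two_power_antimono[OF assms(2)] by (auto simp: in_mcball_of intro: order_trans)
  then have "mspace X \<subseteq> (\<Union>x\<in>C. mcball_of X x (1 / 2 ^ m))"
    by (intro order_trans[OF C(4)] UN_mono order_refl)
  then have "covering_number X m \<le> covering_number X n"
    using covering_number_le[OF C(1,2)] C(3) by simp
  with False show ?thesis
    unfolding entropy_def by (intro nat_mono ceiling_mono) simp
qed (simp add: entropy_def log_def)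

text \<open>Names sharing their first \<open>\<mu> n\<close> bits denote points within
  \<open>1 / 2 ^ n\<close>, so one center per occurring prefix suffices, and there are at most
  \<open>2 ^ \<mu> n\<close> prefixes.\<close>

lemma covering_number_le_modulus:
  assumes "representation X A \<xi>" "modulus (cantor_on A) X \<xi> \<mu>"
  shows "covering_number X n \<le> 2 ^ \<mu> n"
proof -
  \<comment> \<open>The prefix of length \<open>\<mu> n\<close> is encoded as the set of positions
    that carry a 1.\<close>
  let ?h = "\<lambda>u::cantor. {i. i < \<mu> n \<and> u i}"
  have sub: "?h ` A \<subseteq> Pow {..<\<mu> n}" by auto
  \<comment> \<open>\<open>B\<close> picks exactly one name per occurring prefix; injectivity is
    what allows counting \<open>B\<close> by prefixes.\<close>
  obtain B where B: "B \<subseteq> A" "inj_on ?h B" "?h ` A = ?h ` B"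
    using subset_image_inj[of "?h ` A" ?h A] by auto
  have fin: "finite B"
    using sub B(2,3) by (metis finite_Pow_iff finite_imageD finite_lessThan finite_subset)
  have "card B = card (?h ` B)" using B(2) by (simp add: card_image)
  also have "\<dots> \<le> card (Pow {..<\<mu> n})"
    by (rule card_mono) (use sub B(3) in auto)
  finally have card: "card B \<le> 2 ^ \<mu> n" by (simp add: card_Pow)
  have "mspace X \<subseteq> (\<Union>x\<in>\<xi> ` B. mcball_of X x (1 / 2 ^ n))"
  proof
    fix x assume x: "x \<in> mspace X"
    then obtain u where u: "u \<in> A" "x = \<xi> u" using assms(1) by (auto simp: representation_def)
    then obtain v where v: "v \<in> B" "?h u = ?h v" using B by blast
    then have "cantor_dist v u \<le> 1 / 2 ^ \<mu> n" by (auto simp: cantor_dist_le_iff)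
    then have "mdist X (\<xi> v) (\<xi> u) \<le> 1 / 2 ^ n"
      using assms(2) u(1) v(1) B(1) by (auto simp: modulus_cantor_iff)
    moreover have "\<xi> v \<in> mspace X" using assms(1) v(1) B(1) by (auto simp: representation_def)
    ultimately show "x \<in> (\<Union>x\<in>\<xi> ` B. mcball_of X x (1 / 2 ^ n))"
      using u v x by (auto simp: in_mcball_of)
  qed
  moreover have "\<xi> ` B \<subseteq> mspace X" using assms(1) B(1) by (auto simp: representation_def)
  ultimately have "covering_number X n \<le> card (\<xi> ` B)"
    using fin by (intro covering_number_le) auto
  also have "\<dots> \<le> card B" using fin by (rule card_image_le)
  finally show ?thesis using card by simp
qed

lemma entropy_le_modulus:
  assumes "representation X A \<xi>" "modulus (cantor_on A) X \<xi> \<mu>"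
  shows "entropy X n \<le> \<mu> n"
proof (cases "covering_number X n = 0")
  case False
  have "real (covering_number X n) \<le> 2 ^ \<mu> n"
    using covering_number_le_modulus[OF assms, of n] by (metis of_nat_le_iff of_nat_numeral of_nat_power)
  then have "log 2 (real (covering_number X n)) \<le> real (\<mu> n)"
    using False by (simp add: log_le_iff powr_realpow)
  then show ?thesis unfolding entropy_def by linarith
qed (simp add: entropy_def log_def)

text \<open>The \<open>LEAST\<close> over the reals is attained: for equal points it is 0, and for
  distinct points the modulus keeps the distances of names away from 0, which leaves finitely many
  values \<open>1 / 2 ^ k\<close>.\<close>

lemma induced_dist_le_iff:
  assumes \<xi>: "representation X A \<xi>" "modulus (cantor_on A) X \<xi> \<mu>"
    and x: "x \<in> mspace X" "x' \<in> mspace X"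
  shows "induced_dist A \<xi> x x' \<le> r \<longleftrightarrow>
    (\<exists>u\<in>A. \<exists>u'\<in>A. \<xi> u = x \<and> \<xi> u' = x' \<and> cantor_dist u u' \<le> r)"
proof -
  interpret M: Metric_space "mspace X" "mdist X" by (rule Metric_space_mspace_mdist)
  define S where "S = {cantor_dist u u' | u u'. u \<in> A \<and> u' \<in> A \<and> \<xi> u = x \<and> \<xi> u' = x'}"
  have ne: "S \<noteq> {}"
    using \<xi>(1) x by (auto simp: S_def representation_def image_iff) (metis image_iff)
  have "\<exists>s\<in>S. \<forall>t\<in>S. s \<le> t"
  proof (cases "x = x'")
    case True
    obtain u where "u \<in> A" "\<xi> u = x"
      using \<xi>(1) x(1) unfolding representation_def by (metis imageE)
    then have "cantor_dist u u \<in> S" using True by (auto simp: S_def)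
    then have "0 \<in> S" by (simp add: cantor_dist_def)
    moreover have "0 \<le> t" if "t \<in> S" for t using that by (auto simp: S_def cantor_dist_def)
    ultimately show ?thesis by blast
  next
    case False
    then have "0 < mdist X x x'" using x by simp
    then obtain n where n: "(1 / 2) ^ n < mdist X x x'"
      using real_arch_pow_inv[of _ "1/2::real"] by auto
    \<comment> \<open>Names agreeing on \<open>\<mu> n\<close> bits would denote points within
      \<open>1 / 2 ^ n\<close>, against the choice of \<open>n\<close>.\<close>
    have "S \<subseteq> (\<lambda>k. 1 / 2 ^ k) ` {..\<mu> n}"
    proof
      fix s assume "s \<in> S"
      then obtain u u' where u: "u \<in> A" "u' \<in> A" "\<xi> u = x" "\<xi> u' = x'" "s = cantor_dist u u'"
        by (auto simp: S_def)
      then obtain k where k: "s = 1 / 2 ^ k"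
        using False by (auto simp: cantor_dist_def split: if_splits)
      have "\<not> mdist X (\<xi> u) (\<xi> u') \<le> 1 / 2 ^ n" using n u by (simp add: power_one_over)
      then have "\<not> s \<le> 1 / 2 ^ \<mu> n" using \<xi>(2) u by (auto simp: modulus_cantor_iff)
      then have "k \<le> \<mu> n" using k inverse_two_power_antimono[of "\<mu> n" k] by linarith
      then show "s \<in> (\<lambda>k. 1 / 2 ^ k) ` {..\<mu> n}" using k by simp
    qed
    then have "finite S" by (rule finite_subset) simp
    then show ?thesis using ne by (meson Min_in Min_le)
  qed
  then obtain s where s: "s \<in> S" "\<And>t. t \<in> S \<Longrightarrow> s \<le> t" by blast
  have "induced_dist A \<xi> x x' = s"
    unfolding induced_dist_def by (rule Least_equality) (use s in \<open>auto simp: S_def\<close>)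
  then have "induced_dist A \<xi> x x' \<le> r \<longleftrightarrow> (\<exists>t\<in>S. t \<le> r)"
    using s order_trans by blast
  then show ?thesis unfolding S_def by blast
qed


section \<open>Growth classes\<close>

locale growth_class =
  fixes \<G> :: "(nat \<Rightarrow> nat) set"
  assumes growth_mono: "q \<in> \<G> \<Longrightarrow> mono q"
    and growth_comp: "p \<in> \<G> \<Longrightarrow> q \<in> \<G> \<Longrightarrow> p \<circ> q \<in> \<G>"

definition reduction ::
  "(nat \<Rightarrow> nat) set \<Rightarrow> 'a metric \<Rightarrow> cantor set \<Rightarrow> (cantor \<Rightarrow> 'a) \<Rightarrow> cantor set \<Rightarrow> (cantor \<Rightarrow> 'a) \<Rightarrow> bool"
  where
  "reduction \<G> X A' \<xi>' A \<xi> \<longleftrightarrow>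
     (\<exists>G \<nu>. modulus (cantor_on A') (cantor_on A) G \<nu> \<and>
        (\<forall>u\<in>A'. \<xi>' u = \<xi> (G u)) \<and>
        (\<exists>q\<in>\<G>. \<forall>n. \<nu> (minimal_modulus (cantor_on A) X \<xi> n)
                   \<le> minimal_modulus (cantor_on A') X \<xi>' (q n)))"

text \<open>Condition (1) with the standing assumptions on a representation, isolated because
  admissible and standard representations share it.\<close>

definition entropy_bounded ::
  "(nat \<Rightarrow> nat) set \<Rightarrow> 'a metric \<Rightarrow> cantor set \<Rightarrow> (cantor \<Rightarrow> 'a) \<Rightarrow> bool" where
  "entropy_bounded \<G> X A \<xi> \<longleftrightarrow>
     representation X A \<xi> \<and> (\<exists>\<mu>. modulus (cantor_on A) X \<xi> \<mu>) \<and>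
     (\<exists>q\<in>\<G>. \<forall>n. minimal_modulus (cantor_on A) X \<xi> n \<le> entropy X (q n))"

definition admissible ::
  "(nat \<Rightarrow> nat) set \<Rightarrow> 'a metric \<Rightarrow> cantor set \<Rightarrow> (cantor \<Rightarrow> 'a) \<Rightarrow> bool" where
  "admissible \<G> X A \<xi> \<longleftrightarrow> entropy_bounded \<G> X A \<xi> \<and>
     (\<forall>A' \<xi>'. representation X A' \<xi>' \<and> (\<exists>\<mu>'. modulus (cantor_on A') X \<xi>' \<mu>')
        \<longrightarrow> reduction \<G> X A' \<xi>' A \<xi>)"

definition standard ::
  "(nat \<Rightarrow> nat) set \<Rightarrow> 'a metric \<Rightarrow> cantor set \<Rightarrow> (cantor \<Rightarrow> 'a) \<Rightarrow> bool" where
  "standard \<G> X A \<xi> \<longleftrightarrow> entropy_bounded \<G> X A \<xi> \<and>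
     (\<forall>A' \<xi>'. (\<exists>\<mu>'. modulus (cantor_on A') X \<xi>' \<mu>') \<longrightarrow> reduction \<G> X A' \<xi>' A \<xi>) \<and>
     (\<exists>p\<in>\<G>. \<forall>n. \<forall>x\<in>mspace X. \<forall>x'\<in>mspace X.
        mdist X x x' \<le> 1 / 2 ^ p n \<longrightarrow> induced_dist A \<xi> x x' \<le> 1 / 2 ^ entropy X n)"

text \<open>Monotonicity of the entropy belongs here because it rests on finite covers, which the
  representation and its modulus provide.\<close>

lemma entropy_boundedE:
  assumes "entropy_bounded \<G> X A \<xi>"
  obtains q where "representation X A \<xi>"
    "modulus (cantor_on A) X \<xi> (minimal_modulus (cantor_on A) X \<xi>)"
    "q \<in> \<G>" "\<And>n. minimal_modulus (cantor_on A) X \<xi> n \<le> entropy X (q n)"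
    "\<And>m n. m \<le> n \<Longrightarrow> entropy X m \<le> entropy X n"
proof -
  obtain q \<mu> where q: "q \<in> \<G>" "\<And>n. minimal_modulus (cantor_on A) X \<xi> n \<le> entropy X (q n)"
    and \<mu>: "representation X A \<xi>" "modulus (cantor_on A) X \<xi> \<mu>"
    using assms unfolding entropy_bounded_def by blast
  show thesis
    by (rule that[OF \<mu>(1) minimal_modulus(1)[OF \<mu>(2)] q])
      (rule entropy_mono[OF representation_finite_cover[OF \<mu>]])
qed

text \<open>Turns condition (3) from a bound on a \<open>LEAST\<close> into a pair of close names,
  the form in which it is applied.\<close>

lemma standardE:
  assumes "standard \<G> X A \<xi>"
  obtains p where "p \<in> \<G>"
    "\<And>n x x'. x \<in> mspace X \<Longrightarrow> x' \<in> mspace X \<Longrightarrow> mdist X x x' \<le> 1 / 2 ^ p n \<Longrightarrow>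
      \<exists>u\<in>A. \<exists>u'\<in>A. \<xi> u = x \<and> \<xi> u' = x' \<and> cantor_dist u u' \<le> 1 / 2 ^ entropy X n"
proof -
  have b: "entropy_bounded \<G> X A \<xi>" using assms by (simp add: standard_def)
  obtain p where "p \<in> \<G>" "\<And>n x x'. x \<in> mspace X \<Longrightarrow> x' \<in> mspace X \<Longrightarrow>
      mdist X x x' \<le> 1 / 2 ^ p n \<Longrightarrow> induced_dist A \<xi> x x' \<le> 1 / 2 ^ entropy X n"
    using assms unfolding standard_def by blast
  then show thesis
    using that induced_dist_le_iff[where X = X and A = A and \<xi> = \<xi>] b
    unfolding entropy_bounded_def by (metis (no_types, lifting))
qed

section \<open>Parts (a) to (d) for an arbitrary growth class\<close>

context growth_class
begin

text \<open>The composite \<open>H \<circ> G\<close> has modulus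
  \<open>\<nu> \<circ> \<kappa>\<close>. Monotonicity of \<open>\<nu>\<close> lets the two bounds be
  chained, and the index changes compose to \<open>q \<circ> p\<close>.\<close>

lemma reduction_trans:
  assumes "reduction \<G> X A'' \<xi>'' A \<xi>" "reduction \<G> X A \<xi> A' \<xi>'"
  shows "reduction \<G> X A'' \<xi>'' A' \<xi>'"
proof -
  obtain G \<nu> q where G: "modulus (cantor_on A'') (cantor_on A) G \<nu>" "\<forall>u\<in>A''. \<xi>'' u = \<xi> (G u)"
    "q \<in> \<G>" "\<And>n. \<nu> (minimal_modulus (cantor_on A) X \<xi> n)
       \<le> minimal_modulus (cantor_on A'') X \<xi>'' (q n)"
    using assms(1) unfolding reduction_def by blast
  obtain H \<kappa> p where H: "modulus (cantor_on A) (cantor_on A') H \<kappa>" "\<forall>u\<in>A. \<xi> u = \<xi>' (H u)"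
    "p \<in> \<G>" "\<And>n. \<kappa> (minimal_modulus (cantor_on A') X \<xi>' n)
       \<le> minimal_modulus (cantor_on A) X \<xi> (p n)"
    using assms(2) unfolding reduction_def by blast
  have "G \<in> A'' \<rightarrow> A" using G(1) by (auto simp: modulus_def)
  then have "\<forall>u\<in>A''. \<xi>'' u = \<xi>' ((H \<circ> G) u)" using G(2) H(2) by auto
  moreover have "(\<nu> \<circ> \<kappa>) (minimal_modulus (cantor_on A') X \<xi>' n)
      \<le> minimal_modulus (cantor_on A'') X \<xi>'' ((q \<circ> p) n)" for n
    using modulus_mono[OF G(1) H(4)] G(4)[of "p n"] by (auto intro: order_trans)
  ultimately show ?thesis
    using modulus_comp[OF G(1) H(1)] growth_comp[OF G(3) H(3)] unfolding reduction_def by blast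
qed

text \<open>Since \<open>\<xi>\<close> is surjective, admissibility reduces it to
  \<open>\<xi>'\<close>. Any partial map then reduces to \<open>\<xi>'\<close> through
  \<open>\<xi>\<close>, which gives (2'), and pushing close \<open>\<xi>\<close>-names through this
  reduction \<open>H\<close> gives (3).\<close>

lemma admissible_imp_standard:
  assumes "standard \<G> X A \<xi>" "admissible \<G> X A' \<xi>'"
  shows "standard \<G> X A' \<xi>'"
proof -
  have b: "entropy_bounded \<G> X A \<xi>" and b': "entropy_bounded \<G> X A' \<xi>'"
    using assms by (simp_all add: standard_def admissible_def)
  obtain r where r: "representation X A \<xi>"
    "modulus (cantor_on A) X \<xi> (minimal_modulus (cantor_on A) X \<xi>)"
    "r \<in> \<G>" "\<And>n. minimal_modulus (cantor_on A) X \<xi> n \<le> entropy X (r n)"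
    using entropy_boundedE[OF b] by metis
  obtain r' where r': "representation X A' \<xi>'"
    "modulus (cantor_on A') X \<xi>' (minimal_modulus (cantor_on A') X \<xi>')"
    using entropy_boundedE[OF b'] by metis
  have red: "reduction \<G> X A \<xi> A' \<xi>'"
    using assms(2) r(1,2) unfolding admissible_def by blast
  then obtain H \<kappa> q where H: "modulus (cantor_on A) (cantor_on A') H \<kappa>" "\<forall>u\<in>A. \<xi> u = \<xi>' (H u)"
    "q \<in> \<G>" "\<And>n. \<kappa> (minimal_modulus (cantor_on A') X \<xi>' n)
       \<le> minimal_modulus (cantor_on A) X \<xi> (q n)"
    unfolding reduction_def by blast
  obtain p where p: "p \<in> \<G>"
    "\<And>n x x'. x \<in> mspace X \<Longrightarrow> x' \<in> mspace X \<Longrightarrow> mdist X x x' \<le> 1 / 2 ^ p n \<Longrightarrow>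
      \<exists>u\<in>A. \<exists>u'\<in>A. \<xi> u = x \<and> \<xi> u' = x' \<and> cantor_dist u u' \<le> 1 / 2 ^ entropy X n"
    using standardE[OF assms(1)] by metis
  \<comment> \<open>Three estimates: the entropy is below the minimal modulus of
    \<open>\<xi>'\<close>, the reduction bound passes to that of \<open>\<xi>\<close> at
    \<open>q n\<close>, and condition (1) for \<open>\<xi>\<close> returns to the entropy.\<close>
  have le: "\<kappa> (entropy X n) \<le> entropy X (r (q n))" for n
    using modulus_mono[OF H(1) entropy_le_modulus[OF r', of n]] H(4)[of n] r(4)[of "q n"]
    by (meson order_trans)
  have "induced_dist A' \<xi>' x x' \<le> 1 / 2 ^ entropy X n"
    \<comment> \<open>By (3) for \<open>\<xi>\<close> at index \<open>r (q n)\<close>, this distance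
      yields names close enough for \<open>H\<close> to produce images within
      \<open>1 / 2 ^ entropy X n\<close>.\<close>
    if x: "x \<in> mspace X" "x' \<in> mspace X" and d: "mdist X x x' \<le> 1 / 2 ^ (p \<circ> (r \<circ> q)) n" for n x x'
  proof -
    obtain u u' where u: "u \<in> A" "u' \<in> A" "\<xi> u = x" "\<xi> u' = x'"
      "cantor_dist u u' \<le> 1 / 2 ^ entropy X (r (q n))"
      using p(2)[OF x, of "r (q n)"] d by auto
    have "cantor_dist u u' \<le> 1 / 2 ^ \<kappa> (entropy X n)"
      using u(5) inverse_two_power_antimono[OF le] by (rule order_trans)
    then have "H u \<in> A'" "H u' \<in> A'" "cantor_dist (H u) (H u') \<le> 1 / 2 ^ entropy X n"
      using H(1) u(1,2) by (auto simp: modulus_cantor_iff)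
    then show ?thesis
      using induced_dist_le_iff[OF r' x] H(2) u by metis
  qed
  moreover have "p \<circ> (r \<circ> q) \<in> \<G>" using growth_comp p(1) r(3) H(3) by blast
  moreover have "reduction \<G> X A'' \<xi>'' A' \<xi>'" if "modulus (cantor_on A'') X \<xi>'' \<mu>''" for A'' \<xi>'' \<mu>''
    using assms(1) that red reduction_trans unfolding standard_def by blast
  ultimately show ?thesis using b' unfolding standard_def by blast
qed

text \<open>Points within \<open>1 / 2 ^ p (l n)\<close> have names within
  \<open>1 / 2 ^ entropy X (l n)\<close>, which is exactly what the modulus of
  \<open>f \<circ> \<xi>\<close> asks for at precision \<open>n\<close>.\<close>

lemma standard_modulus_descends:
  assumes "standard \<G> X A \<xi>" "f \<in> mspace X \<rightarrow> mspace Y" "mono l"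
    and f: "modulus (cantor_on A) Y (f \<circ> \<xi>) (entropy X \<circ> l)"
  shows "\<exists>p\<in>\<G>. modulus X Y f (p \<circ> l)"
proof -
  obtain p where p: "p \<in> \<G>"
    "\<And>n x x'. x \<in> mspace X \<Longrightarrow> x' \<in> mspace X \<Longrightarrow> mdist X x x' \<le> 1 / 2 ^ p n \<Longrightarrow>
      \<exists>u\<in>A. \<exists>u'\<in>A. \<xi> u = x \<and> \<xi> u' = x' \<and> cantor_dist u u' \<le> 1 / 2 ^ entropy X n"
    using standardE[OF assms(1)] by metis
  have "mdist Y (f x) (f x') \<le> 1 / 2 ^ n"
    if "x \<in> mspace X" "x' \<in> mspace X" "mdist X x x' \<le> 1 / 2 ^ (p \<circ> l) n" for n x x'
    using p(2)[of x x' "l n"] that f by (auto simp: modulus_cantor_iff)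
  then have "modulus X Y f (p \<circ> l)"
    using assms(2,3) growth_mono[OF p(1)] by (auto simp: modulus_def mono_def)
  then show ?thesis using p(1) by blast
qed

text \<open>A reduction of \<open>f \<circ> \<xi>\<close> to \<open>\<upsilon>\<close> is the same
  thing as a realizer of \<open>f\<close>. As \<open>f\<close> may miss points of \<open>Y\<close>,
  this calls for (2'), which admits maps that are not surjective.\<close>

lemma standard_realizer:
  assumes "standard \<G> X A \<xi>" "standard \<G> Y B \<upsilon>" "modulus X Y f l"
  shows "\<exists>F L. realizer A \<xi> B \<upsilon> f F \<and> modulus (cantor_on A) (cantor_on B) F L
    \<and> (\<exists>p\<in>\<G>. \<exists>q\<in>\<G>. \<forall>n. L (entropy Y n) \<le> entropy X (p (l (q n))))"
proof -
  have b: "entropy_bounded \<G> X A \<xi>" and b': "entropy_bounded \<G> Y B \<upsilon>"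
    using assms(1,2) by (simp_all add: standard_def)
  obtain p where p: "modulus (cantor_on A) X \<xi> (minimal_modulus (cantor_on A) X \<xi>)"
    "p \<in> \<G>" "\<And>n. minimal_modulus (cantor_on A) X \<xi> n \<le> entropy X (p n)"
    using entropy_boundedE[OF b] by metis
  obtain r where r: "representation Y B \<upsilon>"
    "modulus (cantor_on B) Y \<upsilon> (minimal_modulus (cantor_on B) Y \<upsilon>)"
    using entropy_boundedE[OF b'] by metis
  have f\<xi>: "modulus (cantor_on A) Y (f \<circ> \<xi>) (minimal_modulus (cantor_on A) X \<xi> \<circ> l)"
    using modulus_comp[OF p(1) assms(3)] .
  then have "reduction \<G> Y A (f \<circ> \<xi>) B \<upsilon>" using assms(2) unfolding standard_def by blast
  then obtain F L q where F: "modulus (cantor_on A) (cantor_on B) F L" "\<forall>u\<in>A. (f \<circ> \<xi>) u = \<upsilon> (F u)"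
    "q \<in> \<G>" "\<And>n. L (minimal_modulus (cantor_on B) Y \<upsilon> n)
       \<le> minimal_modulus (cantor_on A) Y (f \<circ> \<xi>) (q n)"
    unfolding reduction_def by blast
  have "L (entropy Y n) \<le> entropy X (p (l (q n)))" for n
  proof -
    have "L (entropy Y n) \<le> L (minimal_modulus (cantor_on B) Y \<upsilon> n)"
      using modulus_mono[OF F(1) entropy_le_modulus[OF r]] .
    also have "\<dots> \<le> minimal_modulus (cantor_on A) Y (f \<circ> \<xi>) (q n)" by (rule F(4))
    \<comment> \<open>The minimal modulus of \<open>f \<circ> \<xi>\<close> lies below the composite
      of the minimal modulus of \<open>\<xi>\<close> with \<open>l\<close>.\<close>
    also have "\<dots> \<le> minimal_modulus (cantor_on A) X \<xi> (l (q n))"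
      using minimal_modulus(2)[OF f\<xi>, of "q n"] by simp
    also have "\<dots> \<le> entropy X (p (l (q n)))" by (rule p(3))
    finally show ?thesis .
  qed
  moreover have "realizer A \<xi> B \<upsilon> f F"
    using F(1,2) by (auto simp: realizer_def modulus_def)
  ultimately show ?thesis using F(1,3) p(2) by blast
qed

text \<open>On \<open>A\<close> the maps \<open>\<upsilon> \<circ> F\<close> and
  \<open>f \<circ> \<xi>\<close> agree, so a modulus of the former descends to \<open>f\<close> by
  part (b).\<close>

lemma standard_realizer_modulus_descends:
  assumes "standard \<G> X A \<xi>" "standard \<G> Y B \<upsilon>" "mono l" "f \<in> mspace X \<rightarrow> mspace Y"
    and F: "realizer A \<xi> B \<upsilon> f F" "modulus (cantor_on A) (cantor_on B) F (entropy X \<circ> l)"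
  shows "\<exists>p\<in>\<G>. \<exists>q\<in>\<G>. modulus X Y f (p \<circ> l \<circ> entropy Y \<circ> q)"
proof -
  have b: "entropy_bounded \<G> X A \<xi>" and b': "entropy_bounded \<G> Y B \<upsilon>"
    using assms(1,2) by (simp_all add: standard_def)
  have monoX: "entropy X m \<le> entropy X n" if "m \<le> n" for m n
    using entropy_boundedE[OF b] that by metis
  obtain q where q: "modulus (cantor_on B) Y \<upsilon> (minimal_modulus (cantor_on B) Y \<upsilon>)"
    "q \<in> \<G>" "\<And>n. minimal_modulus (cantor_on B) Y \<upsilon> n \<le> entropy Y (q n)"
    "\<And>m n. m \<le> n \<Longrightarrow> entropy Y m \<le> entropy Y n"
    using entropy_boundedE[OF b'] by metis
  have mono: "mono (l \<circ> entropy Y \<circ> q)"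
    using assms(3) q(4) growth_mono[OF q(2)] by (auto simp: mono_def)
  \<comment> \<open>Descent requires the shape \<open>entropy X \<circ> l'\<close> with
    \<open>l'\<close> monotone; condition (1) for \<open>\<upsilon>\<close> allows replacing its
    minimal modulus by \<open>entropy Y \<circ> q\<close>.\<close>
  have "modulus (cantor_on A) Y (\<upsilon> \<circ> F) (entropy X \<circ> (l \<circ> entropy Y \<circ> q))"
  proof (rule modulus_weaken[OF modulus_comp[OF F(2) q(1)]])
    show "mono (entropy X \<circ> (l \<circ> entropy Y \<circ> q))"
      using mono monoX by (auto simp: mono_def)
    show "(entropy X \<circ> l \<circ> minimal_modulus (cantor_on B) Y \<upsilon>) n
        \<le> (entropy X \<circ> (l \<circ> entropy Y \<circ> q)) n" for n
      using monoX monoD[OF assms(3) q(3)] by simp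
  qed
  then have "modulus (cantor_on A) Y (f \<circ> \<xi>) (entropy X \<circ> (l \<circ> entropy Y \<circ> q))"
    by (rule modulus_cong) (use F(1) in \<open>auto simp: realizer_def\<close>)
  from standard_modulus_descends[OF assms(1,4) mono this] q(2) show ?thesis
    by (auto simp: comp_assoc)
qed

end


section \<open>Polynomial and linear growth\<close>

lemma poly_nat_mono: "mono (poly (p :: nat poly))"
  by (intro monoI, induction p) (auto intro: add_mono mult_mono)

lemma poly_nat_le_monomial: "\<exists>c. \<forall>n. poly (p :: nat poly) n \<le> c + c * n ^ c"
proof (induction p)
  case (pCons a p)
  then obtain c where c: "\<And>n. poly p n \<le> c + c * n ^ c" by blast
  \<comment> \<open>The summand \<open>a\<close> covers the constant coefficient,
    \<open>2 * c\<close> the two terms from expanding \<open>n * (c + c * n ^ c)\<close>, and the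
    final 1 makes the exponent at least both 1 and \<open>Suc c\<close>. Raising exponents needs
    \<open>n > 0\<close>, hence the case split.\<close>
  define d where "d = a + 2 * c + 1"
  have "poly (pCons a p) n \<le> d + d * n ^ d" for n
  proof (cases "n = 0")
    case False
    have "n * poly p n \<le> n * (c + c * n ^ c)" using c by (intro mult_le_mono2)
    also have "\<dots> = c * n ^ 1 + c * n ^ Suc c" by (simp add: algebra_simps)
    also have "\<dots> \<le> c * n ^ d + c * n ^ d"
      using False by (intro add_mono mult_le_mono2 power_increasing) (auto simp: d_def)
    also have "\<dots> \<le> d * n ^ d" by (simp add: d_def algebra_simps)
    finally show ?thesis by (simp add: d_def)
  qed (simp add: d_def)
  then show ?case by blast
qed simp

text \<open>The class consists of dominated functions because the bounds themselves are not closed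
  under composition: \<open>n + 1\<close> composed with itself is \<open>n + 2\<close>, which is not
  of the form \<open>c + c * n ^ c\<close>.\<close>

definition polynomial_growth :: "(nat \<Rightarrow> nat) set" where
  "polynomial_growth = {q. mono q \<and> (\<exists>c. \<forall>n. q n \<le> c + c * n ^ c)}"

definition linear_growth :: "(nat \<Rightarrow> nat) set" where
  "linear_growth = {q. mono q \<and> (\<exists>c. \<forall>n. q n \<le> c + c * n)}"

lemma mono_monomial_bound: "mono (\<lambda>n::nat. c + c * n ^ c)"
  by (intro monoI add_mono mult_le_mono2 power_mono) auto

lemma monomial_bound_growth: "(\<lambda>n. c + c * n ^ c) \<in> polynomial_growth"
  using mono_monomial_bound unfolding polynomial_growth_def by blast

lemma linear_bound_growth: "(\<lambda>n. c + c * n) \<in> linear_growth"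
  unfolding linear_growth_def by (auto simp: mono_def intro!: exI[of _ c])

lemma poly_growth: "poly p \<in> polynomial_growth"
  using poly_nat_mono poly_nat_le_monomial unfolding polynomial_growth_def by blast

lemma polynomial_growth_le_poly:
  assumes "q \<in> polynomial_growth" obtains p where "\<And>n. q n \<le> poly p n"
proof -
  obtain c where "\<And>n. q n \<le> c + c * n ^ c" using assms unfolding polynomial_growth_def by blast
  then have "q n \<le> poly ([:c:] + monom c c) n" for n by (simp add: poly_monom)
  then show thesis using that by blast
qed

text \<open>Closure under composition goes through polynomial majorants: these compose as
  polynomials, and the result is again below some \<open>c + c * n ^ c\<close>.\<close>

interpretation polynomial: growth_class polynomial_growth
proof
  fix p q assume p: "p \<in> polynomial_growth" and q: "q \<in> polynomial_growth"
  obtain P Q where P: "\<And>n. p n \<le> poly P n" and Q: "\<And>n. q n \<le> poly Q n"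
    using polynomial_growth_le_poly p q by metis
  have le: "(p \<circ> q) n \<le> poly (pcompose P Q) n" for n
    using P[of "q n"] monoD[OF poly_nat_mono Q[of n]] by (auto simp: poly_pcompose intro: order_trans)
  obtain c where "\<And>n. poly (pcompose P Q) n \<le> c + c * n ^ c" using poly_nat_le_monomial by blast
  then have "\<And>n. (p \<circ> q) n \<le> c + c * n ^ c" using le order_trans by blast
  then show "p \<circ> q \<in> polynomial_growth"
    using p q unfolding polynomial_growth_def by (auto simp: mono_def)
qed (simp add: polynomial_growth_def)

interpretation linear: growth_class linear_growth
proof
  fix p q assume p: "p \<in> linear_growth" and q: "q \<in> linear_growth"
  obtain a b where a: "\<And>n. p n \<le> a + a * n" and b: "\<And>n. q n \<le> b + b * n"
    using p q unfolding linear_growth_def by blast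
  \<comment> \<open>Expanding \<open>a + a * (b + b * n)\<close> gives constant term
    \<open>a + a * b\<close> and slope \<open>a * b\<close>.\<close>
  define c where "c = a + a * b"
  have "(p \<circ> q) n \<le> c + c * n" for n
  proof -
    have "(p \<circ> q) n \<le> a + a * q n" using a by simp
    also have "\<dots> \<le> a + a * (b + b * n)" using b by (intro add_mono mult_le_mono2) auto
    also have "\<dots> \<le> c + c * n" by (simp add: c_def algebra_simps)
    finally show ?thesis .
  qed
  then show "p \<circ> q \<in> linear_growth"
    using p q unfolding linear_growth_def by (auto simp: mono_def)
qed (simp add: linear_growth_def)

text \<open>The functions \<open>b c\<close> lie in the class and dominate it, so a property
  preserved by enlarging the bound has a witness among them as soon as it has one at all. This links
  the explicit bounds of the definitions to the growth classes.\<close>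

lemma bound_growth_iff:
  assumes "\<And>c. b c \<in> \<G>" and "\<And>q. q \<in> \<G> \<Longrightarrow> \<exists>c. \<forall>n. q n \<le> b c n"
    and "\<And>p q. (\<And>n. p n \<le> q n) \<Longrightarrow> P p \<Longrightarrow> P q"
  shows "(\<exists>q\<in>\<G>. P q) \<longleftrightarrow> (\<exists>c. P (b c))"
  using assms by metis

lemma ex_polynomial_growth_iff:
  assumes "\<And>p q. (\<And>n. p n \<le> q n) \<Longrightarrow> P p \<Longrightarrow> P q"
  shows "(\<exists>q\<in>polynomial_growth. P q) \<longleftrightarrow> (\<exists>c. P (\<lambda>n. c + c * n ^ c))"
  by (rule bound_growth_iff[OF monomial_bound_growth _ assms])
    (auto simp: polynomial_growth_def)

text \<open>Condition (3) ranges over polynomials where the other conditions range over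
  \<open>c + c * n ^ c\<close>; both families dominate the same class.\<close>

lemma ex_polynomial_growth_iff_poly:
  assumes "\<And>p q. (\<And>n. p n \<le> q n) \<Longrightarrow> P p \<Longrightarrow> P q"
  shows "(\<exists>q\<in>polynomial_growth. P q) \<longleftrightarrow> (\<exists>p. P (poly p))"
  using assms poly_growth polynomial_growth_le_poly by metis

lemma ex_linear_growth_iff:
  assumes "\<And>p q. (\<And>n. p n \<le> q n) \<Longrightarrow> P p \<Longrightarrow> P q"
  shows "(\<exists>q\<in>linear_growth. P q) \<longleftrightarrow> (\<exists>c. P (\<lambda>n. c + c * n))"
  by (rule bound_growth_iff[OF linear_bound_growth _ assms])
    (auto simp: linear_growth_def)

lemma pointwise_bound_mono:
  fixes g h :: "nat \<Rightarrow> nat"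
  assumes "\<And>m n. m \<le> n \<Longrightarrow> h m \<le> h n" "\<And>n. p n \<le> q n" "\<forall>n. g n \<le> h (p n)"
  shows "\<forall>n. g n \<le> h (q n)"
  using assms by (meson order_trans)

text \<open>The assumed modulus makes the minimal modulus of \<open>\<xi>'\<close> a genuine one,
  hence monotone, so enlarging the index keeps the bound.\<close>

lemma reduction_bound_iffs:
  assumes "modulus (cantor_on A') X \<xi>' \<mu>'"
  shows "reduction polynomial_growth X A' \<xi>' A \<xi> \<longleftrightarrow> polynomial_reduction X A' \<xi>' A \<xi>"
    and "reduction linear_growth X A' \<xi>' A \<xi> \<longleftrightarrow> linear_reduction X A' \<xi>' A \<xi>"
proof -
  note mono = pointwise_bound_mono[where h = "minimal_modulus (cantor_on A') X \<xi>'",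
      OF modulus_mono[OF minimal_modulus(1)[OF assms]]]
  show "reduction polynomial_growth X A' \<xi>' A \<xi> \<longleftrightarrow> polynomial_reduction X A' \<xi>' A \<xi>"
    unfolding reduction_def polynomial_reduction_def
    by (subst ex_polynomial_growth_iff) (rule mono, assumption+, rule refl)
  show "reduction linear_growth X A' \<xi>' A \<xi> \<longleftrightarrow> linear_reduction X A' \<xi>' A \<xi>"
    unfolding reduction_def linear_reduction_def
    by (subst ex_linear_growth_iff) (rule mono, assumption+, rule refl)
qed

lemma entropy_bounded_iffs:
  "entropy_bounded polynomial_growth X A \<xi> \<longleftrightarrow>
     representation X A \<xi> \<and> (\<exists>\<mu>. modulus (cantor_on A) X \<xi> \<mu>) \<and>
     (\<exists>c. \<forall>n. minimal_modulus (cantor_on A) X \<xi> n \<le> entropy X (c + c * n ^ c))"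
  "entropy_bounded linear_growth X A \<xi> \<longleftrightarrow>
     representation X A \<xi> \<and> (\<exists>\<mu>. modulus (cantor_on A) X \<xi> \<mu>) \<and>
     (\<exists>c. \<forall>n. minimal_modulus (cantor_on A) X \<xi> n \<le> entropy X (c + c * n))"
proof -
  have mono: "\<forall>n. g n \<le> entropy X (q n)"
    if "representation X A \<xi>" "modulus (cantor_on A) X \<xi> \<mu>"
      "\<And>n. p n \<le> q n" "\<forall>n. g n \<le> entropy X (p n)" for p q g :: "nat \<Rightarrow> nat" and \<mu>
    using pointwise_bound_mono[where h = "entropy X",
        OF entropy_mono[OF representation_finite_cover[OF that(1,2)]] that(3,4)] .
  show "entropy_bounded polynomial_growth X A \<xi> \<longleftrightarrow>
     representation X A \<xi> \<and> (\<exists>\<mu>. modulus (cantor_on A) X \<xi> \<mu>) \<and>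
     (\<exists>c. \<forall>n. minimal_modulus (cantor_on A) X \<xi> n \<le> entropy X (c + c * n ^ c))"
    \<comment> \<open>Monotonicity of the entropy is available only under the first two conjuncts;
      \<open>conj_cong\<close> supplies them while the third is rewritten.\<close>
    unfolding entropy_bounded_def
    by (intro conj_cong refl ex_polynomial_growth_iff) (elim exE, rule mono, assumption+)
  show "entropy_bounded linear_growth X A \<xi> \<longleftrightarrow>
     representation X A \<xi> \<and> (\<exists>\<mu>. modulus (cantor_on A) X \<xi> \<mu>) \<and>
     (\<exists>c. \<forall>n. minimal_modulus (cantor_on A) X \<xi> n \<le> entropy X (c + c * n))"
    unfolding entropy_bounded_def
    by (intro conj_cong refl ex_linear_growth_iff) (elim exE, rule mono, assumption+)
qed

lemma admissible_iffs:
  "polynomially_admissible X A \<xi> \<longleftrightarrow> admissible polynomial_growth X A \<xi>"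
  "linearly_admissible X A \<xi> \<longleftrightarrow> admissible linear_growth X A \<xi>"
  unfolding polynomially_admissible_def linearly_admissible_def admissible_def entropy_bounded_iffs
  using reduction_bound_iffs by blast+

lemma standard_iffs:
  "polynomially_standard X A \<xi> \<longleftrightarrow> standard polynomial_growth X A \<xi>"
  "linearly_standard X A \<xi> \<longleftrightarrow> standard linear_growth X A \<xi>"
proof -
  \<comment> \<open>A larger exponent strengthens the distance hypothesis, so (3) survives enlarging
    \<open>p\<close>.\<close>
  have mono: "\<forall>n. \<forall>x\<in>mspace X. \<forall>x'\<in>mspace X.
      mdist X x x' \<le> 1 / 2 ^ q n \<longrightarrow> induced_dist A \<xi> x x' \<le> 1 / 2 ^ entropy X n"
    if "\<And>n. p n \<le> q n" "\<forall>n. \<forall>x\<in>mspace X. \<forall>x'\<in>mspace X.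
      mdist X x x' \<le> 1 / 2 ^ p n \<longrightarrow> induced_dist A \<xi> x x' \<le> 1 / 2 ^ entropy X n"
    for p q :: "nat \<Rightarrow> nat"
    using that inverse_two_power_antimono by (meson order_trans)
  have reds:
    "(\<forall>A' \<xi>'. (\<exists>\<mu>'. modulus (cantor_on A') X \<xi>' \<mu>') \<longrightarrow> polynomial_reduction X A' \<xi>' A \<xi>) \<longleftrightarrow>
     (\<forall>A' \<xi>'. (\<exists>\<mu>'. modulus (cantor_on A') X \<xi>' \<mu>') \<longrightarrow> reduction polynomial_growth X A' \<xi>' A \<xi>)"
    "(\<forall>A' \<xi>'. (\<exists>\<mu>'. modulus (cantor_on A') X \<xi>' \<mu>') \<longrightarrow> linear_reduction X A' \<xi>' A \<xi>) \<longleftrightarrow>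
     (\<forall>A' \<xi>'. (\<exists>\<mu>'. modulus (cantor_on A') X \<xi>' \<mu>') \<longrightarrow> reduction linear_growth X A' \<xi>' A \<xi>)"
    using reduction_bound_iffs by blast+
  have "(\<exists>p\<in>polynomial_growth. \<forall>n. \<forall>x\<in>mspace X. \<forall>x'\<in>mspace X.
      mdist X x x' \<le> 1 / 2 ^ p n \<longrightarrow> induced_dist A \<xi> x x' \<le> 1 / 2 ^ entropy X n) \<longleftrightarrow>
    (\<exists>p. \<forall>n. \<forall>x\<in>mspace X. \<forall>x'\<in>mspace X.
      mdist X x x' \<le> 1 / 2 ^ poly p n \<longrightarrow> induced_dist A \<xi> x x' \<le> 1 / 2 ^ entropy X n)"
    by (rule ex_polynomial_growth_iff_poly) (rule mono)
  then show "polynomially_standard X A \<xi> \<longleftrightarrow> standard polynomial_growth X A \<xi>"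
    unfolding polynomially_standard_def standard_def entropy_bounded_iffs
    using reds(1) by (simp only: conj_assoc)
  have "(\<exists>p\<in>linear_growth. \<forall>n. \<forall>x\<in>mspace X. \<forall>x'\<in>mspace X.
      mdist X x x' \<le> 1 / 2 ^ p n \<longrightarrow> induced_dist A \<xi> x x' \<le> 1 / 2 ^ entropy X n) \<longleftrightarrow>
    (\<exists>c. \<forall>n. \<forall>x\<in>mspace X. \<forall>x'\<in>mspace X.
      mdist X x x' \<le> 1 / 2 ^ (c + c * n) \<longrightarrow> induced_dist A \<xi> x x' \<le> 1 / 2 ^ entropy X n)"
    by (rule ex_linear_growth_iff) (rule mono)
  then show "linearly_standard X A \<xi> \<longleftrightarrow> standard linear_growth X A \<xi>"
    unfolding linearly_standard_def standard_def entropy_bounded_iffs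
    using reds(2) by (simp only: conj_assoc)
qed

section \<open>Explicit bounds from growth-class witnesses\<close>

lemma standard_entropy_mono: "standard \<G> X A \<xi> \<Longrightarrow> mono (entropy X)"
  by (metis entropy_boundedE monoI standard_def)

text \<open>One constant must serve both inside and outside \<open>l\<close>; the sum of the two
  given ones works because \<open>l\<close> is monotone.\<close>

lemma linear_growth_pair:
  assumes "p \<in> linear_growth" "q \<in> linear_growth" "mono l"
  obtains c where "\<And>n. p (l (q n)) \<le> c + c * l (c + c * n)"
proof -
  obtain a b where a: "\<And>n. p n \<le> a + a * n" and b: "\<And>n. q n \<le> b + b * n"
    using assms(1,2) unfolding linear_growth_def by blast
  have "p (l (q n)) \<le> (a + b) + (a + b) * l ((a + b) + (a + b) * n)" for n
  proof -
    have "q n \<le> (a + b) + (a + b) * n" using b[of n] by (simp add: algebra_simps)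
    then have "l (q n) \<le> l ((a + b) + (a + b) * n)" by (rule monoD[OF assms(3)])
    then have "a + a * l (q n) \<le> (a + b) + (a + b) * l ((a + b) + (a + b) * n)"
      by (intro add_mono mult_le_mono) auto
    then show ?thesis using a order_trans by blast
  qed
  then show thesis using that by blast
qed

lemma polynomial_growth_pair:
  assumes "p \<in> polynomial_growth" "q \<in> polynomial_growth" "mono l"
  obtains P Q where "\<And>n. p (l (q n)) \<le> poly P (l (poly Q n))"
proof -
  obtain P Q where P: "\<And>n. p n \<le> poly P n" and Q: "\<And>n. q n \<le> poly Q n"
    using polynomial_growth_le_poly assms(1,2) by metis
  have "p (l (q n)) \<le> poly P (l (poly Q n))" for n
    using P monoD[OF poly_nat_mono monoD[OF assms(3) Q]] order_trans by blast
  then show thesis using that by blast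
qed

section \<open>The polynomial and linear statements\<close>

theorem theorem17:
  fixes X :: "'a metric" and Y :: "'b metric"
    and A A' B :: "cantor set"
    and \<xi> \<xi>' :: "cantor \<Rightarrow> 'a" and \<upsilon> :: "cantor \<Rightarrow> 'b"
    and f :: "'a \<Rightarrow> 'b" and l :: "nat \<Rightarrow> nat"
  shows
    "(polynomially_standard X A \<xi> \<and> polynomially_admissible X A' \<xi>'
        \<longrightarrow> polynomially_standard X A' \<xi>')
     \<and>
     (linearly_standard X A \<xi> \<and> linearly_admissible X A' \<xi>'
        \<longrightarrow> linearly_standard X A' \<xi>')
     \<and>
     (polynomially_standard X A \<xi> \<and> f \<in> mspace X \<rightarrow> mspace Y \<and> mono l
        \<and> modulus (cantor_on A) Y (f \<circ> \<xi>) (entropy X \<circ> l)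
        \<longrightarrow> (\<exists>c. modulus X Y f (\<lambda>n. c + c * l n ^ c)))
     \<and>
     (linearly_standard X A \<xi> \<and> f \<in> mspace X \<rightarrow> mspace Y \<and> mono l
        \<and> modulus (cantor_on A) Y (f \<circ> \<xi>) (entropy X \<circ> l)
        \<longrightarrow> (\<exists>c. modulus X Y f (\<lambda>n. c + c * l n)))
     \<and>
     (polynomially_standard X A \<xi> \<and> polynomially_standard Y B \<upsilon>
        \<and> mono l \<and> modulus X Y f l
        \<longrightarrow> (\<exists>F L. realizer A \<xi> B \<upsilon> f F \<and> modulus (cantor_on A) (cantor_on B) F L
              \<and> (\<exists>p q :: nat poly. \<forall>n. L (entropy Y n) \<le> entropy X (poly p (l (poly q n))))))
     \<and>
     (linearly_standard X A \<xi> \<and> linearly_standard Y B \<upsilon>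
        \<and> mono l \<and> modulus X Y f l
        \<longrightarrow> (\<exists>F L. realizer A \<xi> B \<upsilon> f F \<and> modulus (cantor_on A) (cantor_on B) F L
              \<and> (\<exists>c. \<forall>n. L (entropy Y n) \<le> entropy X (c + c * l (c + c * n)))))
     \<and>
     (polynomially_standard X A \<xi> \<and> polynomially_standard Y B \<upsilon>
        \<and> mono l \<and> f \<in> mspace X \<rightarrow> mspace Y
        \<and> (\<exists>F. realizer A \<xi> B \<upsilon> f F \<and> modulus (cantor_on A) (cantor_on B) F (entropy X \<circ> l))
        \<longrightarrow> (\<exists>p q :: nat poly. modulus X Y f (poly p \<circ> l \<circ> entropy Y \<circ> poly q)))
     \<and>
     (linearly_standard X A \<xi> \<and> linearly_standard Y B \<upsilon>
        \<and> mono l \<and> f \<in> mspace X \<rightarrow> mspace Y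
        \<and> (\<exists>F. realizer A \<xi> B \<upsilon> f F \<and> modulus (cantor_on A) (cantor_on B) F (entropy X \<circ> l))
        \<longrightarrow> (\<exists>c. modulus X Y f (\<lambda>n. c + c * l (entropy Y (c + c * n)))))"
proof (intro conjI impI; elim conjE exE; unfold standard_iffs admissible_iffs)
  assume "standard polynomial_growth X A \<xi>" "admissible polynomial_growth X A' \<xi>'"
  then show "standard polynomial_growth X A' \<xi>'" by (rule polynomial.admissible_imp_standard)
next
  assume "standard linear_growth X A \<xi>" "admissible linear_growth X A' \<xi>'"
  then show "standard linear_growth X A' \<xi>'" by (rule linear.admissible_imp_standard)
next
  assume "standard polynomial_growth X A \<xi>" "f \<in> mspace X \<rightarrow> mspace Y" and l: "mono l"
    and "modulus (cantor_on A) Y (f \<circ> \<xi>) (entropy X \<circ> l)"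
  then obtain p where p: "p \<in> polynomial_growth" "modulus X Y f (p \<circ> l)"
    using polynomial.standard_modulus_descends by blast
  then obtain c where "\<And>n. p n \<le> c + c * n ^ c" unfolding polynomial_growth_def by blast
  \<comment> \<open>A modulus is monotone by definition, so enlarging \<open>p \<circ> l\<close> to
    the explicit bound requires checking this again.\<close>
  moreover have "mono (\<lambda>n. c + c * l n ^ c)"
    by (intro monoI monoD[OF mono_monomial_bound] monoD[OF l])
  ultimately have "modulus X Y f (\<lambda>n. c + c * l n ^ c)"
    by (intro modulus_weaken[OF p(2)]) auto
  then show "\<exists>c. modulus X Y f (\<lambda>n. c + c * l n ^ c)" by blast
next
  assume "standard linear_growth X A \<xi>" "f \<in> mspace X \<rightarrow> mspace Y" and l: "mono l"
    and "modulus (cantor_on A) Y (f \<circ> \<xi>) (entropy X \<circ> l)"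
  then obtain p where p: "p \<in> linear_growth" "modulus X Y f (p \<circ> l)"
    using linear.standard_modulus_descends by blast
  then obtain c where "\<And>n. p n \<le> c + c * n" unfolding linear_growth_def by blast
  moreover have "mono (\<lambda>n. c + c * l n)" using l by (auto simp: mono_def)
  ultimately have "modulus X Y f (\<lambda>n. c + c * l n)"
    by (intro modulus_weaken[OF p(2)]) auto
  then show "\<exists>c. modulus X Y f (\<lambda>n. c + c * l n)" by blast
next
  assume X: "standard polynomial_growth X A \<xi>" and Y: "standard polynomial_growth Y B \<upsilon>"
    and l: "mono l" and f: "modulus X Y f l"
  obtain F L p q where F: "realizer A \<xi> B \<upsilon> f F" "modulus (cantor_on A) (cantor_on B) F L"
    and pq: "p \<in> polynomial_growth" "q \<in> polynomial_growth"
    and L: "\<And>n. L (entropy Y n) \<le> entropy X (p (l (q n)))"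
    using polynomial.standard_realizer[OF X Y f] by blast
  obtain P Q where "\<And>n. p (l (q n)) \<le> poly P (l (poly Q n))"
    using polynomial_growth_pair[OF pq l] by metis
  then have "\<forall>n. L (entropy Y n) \<le> entropy X (poly P (l (poly Q n)))"
    using L monoD[OF standard_entropy_mono[OF X]] order_trans by meson
  with F show "\<exists>F L. realizer A \<xi> B \<upsilon> f F \<and> modulus (cantor_on A) (cantor_on B) F L
      \<and> (\<exists>p q :: nat poly. \<forall>n. L (entropy Y n) \<le> entropy X (poly p (l (poly q n))))" by blast
next
  assume X: "standard linear_growth X A \<xi>" and Y: "standard linear_growth Y B \<upsilon>"
    and l: "mono l" and f: "modulus X Y f l"
  obtain F L p q where F: "realizer A \<xi> B \<upsilon> f F" "modulus (cantor_on A) (cantor_on B) F L"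
    and pq: "p \<in> linear_growth" "q \<in> linear_growth"
    and L: "\<And>n. L (entropy Y n) \<le> entropy X (p (l (q n)))"
    using linear.standard_realizer[OF X Y f] by blast
  obtain c where "\<And>n. p (l (q n)) \<le> c + c * l (c + c * n)"
    using linear_growth_pair[OF pq l] by metis
  then have "\<forall>n. L (entropy Y n) \<le> entropy X (c + c * l (c + c * n))"
    using L monoD[OF standard_entropy_mono[OF X]] order_trans by meson
  with F show "\<exists>F L. realizer A \<xi> B \<upsilon> f F \<and> modulus (cantor_on A) (cantor_on B) F L
      \<and> (\<exists>c. \<forall>n. L (entropy Y n) \<le> entropy X (c + c * l (c + c * n)))" by blast
next
  fix F
  assume X: "standard polynomial_growth X A \<xi>" and Y: "standard polynomial_growth Y B \<upsilon>"
    and l: "mono l" and f: "f \<in> mspace X \<rightarrow> mspace Y" and F: "realizer A \<xi> B \<upsilon> f F"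
      "modulus (cantor_on A) (cantor_on B) F (entropy X \<circ> l)"
  obtain p q where pq: "p \<in> polynomial_growth" "q \<in> polynomial_growth"
    and m: "modulus X Y f (p \<circ> l \<circ> entropy Y \<circ> q)"
    using polynomial.standard_realizer_modulus_descends[OF X Y l f F] by blast
  \<comment> \<open>In (d) the monotone function enclosed by the two growth functions is
    \<open>l \<circ> entropy Y\<close> instead of \<open>l\<close>.\<close>
  have l': "mono (l \<circ> entropy Y)" using l standard_entropy_mono[OF Y] by (auto simp: mono_def)
  obtain P Q where PQ: "\<And>n. p ((l \<circ> entropy Y) (q n)) \<le> poly P ((l \<circ> entropy Y) (poly Q n))"
    using polynomial_growth_pair[OF pq l'] by metis
  have "mono (poly P \<circ> l \<circ> entropy Y \<circ> poly Q)"
    using l' poly_nat_mono[of P] poly_nat_mono[of Q] by (auto simp: mono_def)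
  then have "modulus X Y f (poly P \<circ> l \<circ> entropy Y \<circ> poly Q)"
    by (rule modulus_weaken[OF m]) (use PQ in simp)
  then show "\<exists>p q :: nat poly. modulus X Y f (poly p \<circ> l \<circ> entropy Y \<circ> poly q)" by blast
next
  fix F
  assume X: "standard linear_growth X A \<xi>" and Y: "standard linear_growth Y B \<upsilon>"
    and l: "mono l" and f: "f \<in> mspace X \<rightarrow> mspace Y" and F: "realizer A \<xi> B \<upsilon> f F"
      "modulus (cantor_on A) (cantor_on B) F (entropy X \<circ> l)"
  obtain p q where pq: "p \<in> linear_growth" "q \<in> linear_growth"
    and m: "modulus X Y f (p \<circ> l \<circ> entropy Y \<circ> q)"
    using linear.standard_realizer_modulus_descends[OF X Y l f F] by blast
  have l': "mono (l \<circ> entropy Y)" using l standard_entropy_mono[OF Y] by (auto simp: mono_def)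
  obtain c where c: "\<And>n. p ((l \<circ> entropy Y) (q n)) \<le> c + c * (l \<circ> entropy Y) (c + c * n)"
    using linear_growth_pair[OF pq l'] by metis
  have "mono (\<lambda>n. c + c * l (entropy Y (c + c * n)))"
    using l' by (auto simp: mono_def)
  then have "modulus X Y f (\<lambda>n. c + c * l (entropy Y (c + c * n)))"
    by (rule modulus_weaken[OF m]) (use c in simp)
  then show "\<exists>c. modulus X Y f (\<lambda>n. c + c * l (entropy Y (c + c * n)))" by blast
qed

end
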